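(* Let $E$ and $F$ be Banach lattices, let $T:E\to F$ be an almost interval preserving operator, and let $A\subseteq E$. If $A$ is almost Dunford-Pettis in $E$, then $T(A)$ is almost Dunford-Pettis in $F$. If $A$ is almost limited in $E$, then $T(A)$ is almost limited in $F$.
   Context: A subset $A$ of a Banach lattice $E$ is almost Dunford-Pettis (resp. almost limited) if every disjoint weakly null (resp. disjoint weak$^*$ null) sequence $(f_n)$ in $E^*$ converges to $0$ uniformly on $A$, i.e. $\lim_{n}\sup_{a\in A}|f_n(a)|=0$. A positive linear operator $T:E\to F$ between Banach lattices is almost interval preserving if $T[0,x]$ is dense in $[0,Tx]$ for every $x\in E^+$. *)

theory Defs
  imports "HOL-Analysis.Analysis" "HOL-Library.Lattice_Algebras"
begin

section \<open>Banach lattices\<close>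

class banach_lattice = banach + ordered_real_vector + lattice_ab_group_add_abs +
  assumes norm_lattice_mono: "\<bar>x\<bar> \<le> \<bar>y\<bar> \<Longrightarrow> norm x \<le> norm y"

instance real :: banach_lattice
  by standard (auto simp: sup_real_def abs_if)


section \<open>The order structure of the dual\<close>

text \<open>
  The norm dual of a real Banach lattice is the type \<^typ>\<open>'a \<Rightarrow>\<^sub>L real\<close>, which carries no
  order in the library. Its lattice operations are therefore expressed as least upper and
  greatest lower bounds with respect to the dual order; the modulus of every functional
  exists by the Riesz--Kantorovich theorem and is unique since the dual order is antisymmetric.
\<close>

definition dual_le :: "('a::banach_lattice \<Rightarrow>\<^sub>L real) \<Rightarrow> ('a \<Rightarrow>\<^sub>L real) \<Rightarrow> bool" where
  "dual_le f g \<longleftrightarrow> (\<forall>x\<ge>0. blinfun_apply f x \<le> blinfun_apply g x)"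

definition dual_is_sup ::
    "('a::banach_lattice \<Rightarrow>\<^sub>L real) \<Rightarrow> ('a \<Rightarrow>\<^sub>L real) \<Rightarrow> ('a \<Rightarrow>\<^sub>L real) \<Rightarrow> bool" where
  "dual_is_sup f g s \<longleftrightarrow> dual_le f s \<and> dual_le g s \<and>
     (\<forall>h. dual_le f h \<longrightarrow> dual_le g h \<longrightarrow> dual_le s h)"

definition dual_is_inf ::
    "('a::banach_lattice \<Rightarrow>\<^sub>L real) \<Rightarrow> ('a \<Rightarrow>\<^sub>L real) \<Rightarrow> ('a \<Rightarrow>\<^sub>L real) \<Rightarrow> bool" where
  "dual_is_inf f g i \<longleftrightarrow> dual_le i f \<and> dual_le i g \<and>
     (\<forall>h. dual_le h f \<longrightarrow> dual_le h g \<longrightarrow> dual_le h i)"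

definition dual_is_modulus :: "('a::banach_lattice \<Rightarrow>\<^sub>L real) \<Rightarrow> ('a \<Rightarrow>\<^sub>L real) \<Rightarrow> bool" where
  "dual_is_modulus f m \<longleftrightarrow> dual_is_sup f (- f) m"

definition dual_disjoint :: "('a::banach_lattice \<Rightarrow>\<^sub>L real) \<Rightarrow> ('a \<Rightarrow>\<^sub>L real) \<Rightarrow> bool" where
  "dual_disjoint f g \<longleftrightarrow>
     (\<exists>m n. dual_is_modulus f m \<and> dual_is_modulus g n \<and> dual_is_inf m n 0)"

definition disjoint_seq :: "(nat \<Rightarrow> 'a::banach_lattice \<Rightarrow>\<^sub>L real) \<Rightarrow> bool" where
  "disjoint_seq f \<longleftrightarrow> (\<forall>m n. m \<noteq> n \<longrightarrow> dual_disjoint (f m) (f n))"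


section \<open>Almost Dunford-Pettis and almost limited sets\<close>

definition weakly_null :: "(nat \<Rightarrow> 'a::real_normed_vector) \<Rightarrow> bool" where
  "weakly_null x \<longleftrightarrow> (\<forall>\<phi> :: 'a \<Rightarrow>\<^sub>L real. (\<lambda>n. blinfun_apply \<phi> (x n)) \<longlonglongrightarrow> 0)"

definition weak_star_null :: "(nat \<Rightarrow> 'a::real_normed_vector \<Rightarrow>\<^sub>L real) \<Rightarrow> bool" where
  "weak_star_null f \<longleftrightarrow> (\<forall>x. (\<lambda>n. blinfun_apply (f n) x) \<longlonglongrightarrow> 0)"

text \<open>
  The set is not assumed to be bounded, so the supremum of \<open>\<bar>f n a\<bar>\<close> over it may be
  infinite for some \<open>n\<close>; uniform convergence to \<open>0\<close> is well-defined without any convention.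
\<close>

definition almost_dunford_pettis :: "'a::banach_lattice set \<Rightarrow> bool" where
  "almost_dunford_pettis A \<longleftrightarrow>
     (\<forall>f :: nat \<Rightarrow> 'a \<Rightarrow>\<^sub>L real. disjoint_seq f \<longrightarrow> weakly_null f \<longrightarrow>
        uniform_limit A (\<lambda>n. blinfun_apply (f n)) (\<lambda>_. 0) sequentially)"

definition almost_limited :: "'a::banach_lattice set \<Rightarrow> bool" where
  "almost_limited A \<longleftrightarrow>
     (\<forall>f :: nat \<Rightarrow> 'a \<Rightarrow>\<^sub>L real. disjoint_seq f \<longrightarrow> weak_star_null f \<longrightarrow>
        uniform_limit A (\<lambda>n. blinfun_apply (f n)) (\<lambda>_. 0) sequentially)"


section \<open>Almost interval preserving operators\<close>

text \<open>
  Positive operators between Banach lattices are automatically bounded. Positivity gives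
  \<open>T ` {0..x} \<subseteq> {0..T x}\<close>, so the last conjunct says that \<open>T ` {0..x}\<close> is dense
  in \<open>{0..T x}\<close>.
\<close>

definition almost_interval_preserving ::
    "('a::banach_lattice \<Rightarrow> 'b::banach_lattice) \<Rightarrow> bool" where
  "almost_interval_preserving T \<longleftrightarrow> linear T \<and> (\<forall>x\<ge>0. 0 \<le> T x) \<and>
     (\<forall>x\<ge>0. {0..T x} \<subseteq> closure (T ` {0..x}))"

end

theory Submission
  imports Defs
begin

text \<open>
  The adjoint of \<open>T\<close> is a lattice homomorphism: by the Riesz--Kantorovich formula the supremum of
  two functionals at \<open>T x\<close> is a supremum over the order interval \<open>{0..T x}\<close>, which may be taken
  over its dense subset \<open>T ` {0..x}\<close> instead. So the adjoint preserves disjointness, and being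
  weak and weak* continuous it maps (weakly, weak*) null disjoint sequences to such sequences.
  Uniform convergence of \<open>f n\<close> on \<open>T ` A\<close> is uniform convergence of \<open>f n \<circ> T\<close> on \<open>A\<close>.
\<close>

section \<open>Positive operators on Banach lattices are bounded\<close>

lemma banach_lattice_norm_mono:
  fixes x y :: "'a::banach_lattice"
  assumes "0 \<le> x" "x \<le> y"
  shows "norm x \<le> norm y"
  using assms by (intro norm_lattice_mono) auto

lemma banach_lattice_norm_abs [simp]: "norm \<bar>x\<bar> = norm (x::'a::banach_lattice)"
  by (intro antisym norm_lattice_mono) auto

lemma norm_pprt_le: "norm (pprt x) \<le> norm (x::'a::banach_lattice)"
proof -
  have "pprt x \<le> \<bar>x\<bar>"
    by (simp add: pprt_def abs_ge_self)
  then show ?thesis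
    using banach_lattice_norm_mono[of "pprt x" "\<bar>x\<bar>"] by simp
qed

text \<open>For positive \<open>y n\<close> tending to \<open>x\<close>, the negative part
  \<open>pprt (- x)\<close> is dominated by \<open>\<bar>y n - x\<bar>\<close>; its norm is thus
  bounded by a null sequence and vanishes.\<close>

lemma closed_positive_cone: "closed {0::'a::banach_lattice..}"
proof (subst closed_sequential_limits, intro allI impI, elim conjE)
  fix y :: "nat \<Rightarrow> 'a" and x
  assume y: "\<forall>n. y n \<in> {0..}" and lim: "y \<longlonglongrightarrow> x"
  have "norm (pprt (- x)) \<le> norm (y n - x)" for n
  proof -
    have "- x \<le> y n - x"
      using y by simp
    also have "\<dots> \<le> \<bar>y n - x\<bar>"
      by (simp add: abs_ge_self)
    finally have "pprt (- x) \<le> \<bar>y n - x\<bar>"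
      by (simp add: pprt_def)
    then show ?thesis
      using banach_lattice_norm_mono[of "pprt (- x)" "\<bar>y n - x\<bar>"] by simp
  qed
  moreover have "(\<lambda>n. norm (y n - x)) \<longlonglongrightarrow> 0"
    using lim by (simp add: LIM_zero tendsto_norm_zero)
  ultimately have "norm (pprt (- x)) \<le> 0"
    by (intro LIMSEQ_le_const) auto
  then have "pprt (- x) = 0"
    by simp
  then show "x \<in> {0..}"
    by (simp add: pprt_neg zero_le_iff_zero_nprt)
qed

text \<open>Once the partial sums contain the index \<open>n\<close>, subtracting \<open>z n\<close>
  leaves a sum of positive terms; closedness of the cone carries this to the limit.\<close>

lemma positive_sum_le_suminf:
  fixes z :: "nat \<Rightarrow> 'a::banach_lattice"
  assumes "summable z" "\<And>n. 0 \<le> z n"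
  shows "z n \<le> suminf z"
proof -
  have "(\<lambda>k. sum z {..<k} - z n) \<longlonglongrightarrow> suminf z - z n"
    using assms(1) by (intro tendsto_intros summable_LIMSEQ)
  moreover have "\<forall>\<^sub>F k in sequentially. sum z {..<k} - z n \<in> {0..}"
    using eventually_gt_at_top[of n]
  proof eventually_elim
    case (elim k)
    then show ?case
      using assms(2) sum_mono2[of "{..<k}" "{n}" z] by simp
  qed
  ultimately have "suminf z - z n \<in> {0..}"
    by (intro Lim_in_closed_set[OF closed_positive_cone, rotated 2]) auto
  then show ?thesis
    by simp
qed

text \<open>Were \<open>T\<close> unbounded on the cone, some positive vectors with summable norms
  would have images of arbitrarily large norm, yet the image of their sum dominates all of these.
  Splitting into positive and negative parts carries the bound to the whole space.\<close>

lemma positive_operator_bounded_linear: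
  fixes T :: "'a::banach_lattice \<Rightarrow> 'b::banach_lattice"
  assumes lin: "linear T" and pos: "\<And>x. 0 \<le> x \<Longrightarrow> 0 \<le> T x"
  shows "bounded_linear T"
proof -
  have mono: "T x \<le> T y" if "x \<le> y" for x y
    using pos[of "y - x"] that by (simp add: linear_diff[OF lin])
  have "\<exists>K. \<forall>x\<ge>0. norm (T x) \<le> K * norm x"
  proof (rule ccontr)
    assume "\<not> ?thesis"
    \<comment> \<open>The factor is chosen so that rescaling to norm \<open>(1/2) ^ n\<close> gives
      a convergent series while the image norms still exceed \<open>n\<close>.\<close>
    then have "\<exists>x\<ge>0. norm (T x) > real n * 2 ^ n * norm x" for n
      by (meson not_le)
    then obtain x where x: "\<And>n. 0 \<le> x n" "\<And>n. norm (T (x n)) > real n * 2 ^ n * norm (x n)"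
      by metis
    have nz: "norm (x n) > 0" for n
      using x(2)[of n] linear_0[OF lin] by (cases "x n = 0") auto
    define z where "z n = (1 / (2 ^ n * norm (x n))) *\<^sub>R x n" for n
    have z_pos: "0 \<le> z n" for n
      unfolding z_def using x(1) by (intro scaleR_nonneg_nonneg) auto
    have norm_z: "norm (z n) = (1/2) ^ n" for n
      using nz[of n] by (simp add: z_def power_divide)
    have "summable z"
      by (rule summable_norm_cancel) (simp add: norm_z summable_geometric)
    then have "T (z n) \<le> T (suminf z)" for n
      using positive_sum_le_suminf z_pos by (intro mono) blast
    then have "norm (T (z n)) \<le> norm (T (suminf z))" for n
      using pos z_pos by (intro banach_lattice_norm_mono) auto
    moreover have "real n < norm (T (z n))" for n
      using x(2)[of n] nz[of n] by (simp add: z_def linear_cmul[OF lin] field_simps)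
    ultimately have "real n < norm (T (suminf z))" for n
      by (meson less_le_trans)
    then show False
      using reals_Archimedean2 by (meson not_less_iff_gr_or_eq)
  qed
  then obtain K where K: "\<And>x. 0 \<le> x \<Longrightarrow> norm (T x) \<le> K * norm x"
    by blast
  \<comment> \<open>The positive and the negative part contribute one \<open>\<bar>K\<bar>\<close>
    each; the absolute value covers a negative \<open>K\<close>.\<close>
  have "norm (T x) \<le> norm x * (2 * \<bar>K\<bar>)" for x
  proof -
    have part: "norm (T (pprt y)) \<le> \<bar>K\<bar> * norm y" for y
    proof -
      have "norm (T (pprt y)) \<le> K * norm (pprt y)"
        by (intro K) simp
      also have "\<dots> \<le> \<bar>K\<bar> * norm y"
        by (intro mult_mono norm_pprt_le) auto
      finally show ?thesis .
    qed
    have "x = pprt x - pprt (- x)"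
      using prts[of x] by (simp add: pprt_neg)
    then have "T x = T (pprt x) - T (pprt (- x))"
      using linear_diff[OF lin] by metis
    then have "norm (T x) \<le> norm (T (pprt x)) + norm (T (pprt (- x)))"
      by (metis norm_triangle_ineq4)
    also have "\<dots> \<le> \<bar>K\<bar> * norm x + \<bar>K\<bar> * norm (- x)"
      by (intro add_mono part)
    finally show ?thesis
      by (simp add: mult_ac)
  qed
  then show ?thesis
    using lin by (intro bounded_linear.intro bounded_linear_axioms.intro) auto
qed

section \<open>The Riesz--Kantorovich formula\<close>

text \<open>The witness is \<open>v = inf u x\<close>. The remainder stays below \<open>y\<close>
  because \<open>u - y\<close> is below both \<open>u\<close> and \<open>x\<close>.\<close>

lemma riesz_decomposition:
  fixes u x y :: "'a::lattice_ab_group_add"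
  assumes "0 \<le> u" "u \<le> x + y" "0 \<le> x" "0 \<le> y"
  obtains v w where "u = v + w" "0 \<le> v" "v \<le> x" "0 \<le> w" "w \<le> y"
proof
  show "u = inf u x + (u - inf u x)"
    by (metis add.commute diff_add_cancel)
  have "inf u x \<le> u"
    by simp
  then show "0 \<le> u - inf u x"
    by (metis diff_ge_0_iff_ge)
  show "0 \<le> inf u x" "inf u x \<le> x"
    using assms by auto
  have "u - y \<le> inf u x"
    using assms by (simp add: algebra_simps)
  then show "u - inf u x \<le> y"
    by (metis add.commute diff_le_eq)
qed

text \<open>This \<open>s\<close> is the positive part of \<open>f\<close> in the dual. The supremum
  is additive and positively homogeneous on the cone, and extends to the whole space by
  differences.\<close>

lemma riesz_kantorovich_pos:
  fixes f :: "'a::banach_lattice \<Rightarrow>\<^sub>L real"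
  obtains s where "\<And>x. 0 \<le> x \<Longrightarrow> blinfun_apply s x = (SUP u\<in>{0..x}. blinfun_apply f u)"
    "\<And>x. 0 \<le> x \<Longrightarrow> bdd_above (blinfun_apply f ` {0..x})"
proof -
  define p where "p x = (SUP u\<in>{0..x}. blinfun_apply f u)" for x
  have bound: "blinfun_apply f u \<le> norm f * norm x" if "u \<in> {0..x}" for u x
  proof -
    have "blinfun_apply f u \<le> norm f * norm u"
      using norm_blinfun[of f u] by simp
    also have "\<dots> \<le> norm f * norm x"
      using that by (intro mult_left_mono banach_lattice_norm_mono) auto
    finally show ?thesis .
  qed
  then have bdd: "bdd_above (blinfun_apply f ` {0..x})" for x
    by (intro bdd_aboveI2)
  have le_p: "blinfun_apply f u \<le> p x" if "0 \<le> u" "u \<le> x" for u x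
    unfolding p_def using that by (intro cSUP_upper bdd) auto
  have p_le: "p x \<le> c" if "0 \<le> x" "\<And>u. 0 \<le> u \<Longrightarrow> u \<le> x \<Longrightarrow> blinfun_apply f u \<le> c" for x c
    unfolding p_def using that by (intro cSUP_least) auto
  have p_nonneg: "0 \<le> p x" if "0 \<le> x" for x
    using le_p[of 0 x] that by (simp add: blinfun.zero_right)
  have p_bound: "p x \<le> norm f * norm x" if "0 \<le> x" for x
    using that bound by (intro p_le) auto
  have p_add: "p (x + y) = p x + p y" if xy: "0 \<le> x" "0 \<le> y" for x y
  proof (rule antisym)
    show "p (x + y) \<le> p x + p y"
    proof (rule p_le)
      fix u assume "0 \<le> u" "u \<le> x + y"
      then obtain v w where "u = v + w" "0 \<le> v" "v \<le> x" "0 \<le> w" "w \<le> y"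
        using xy riesz_decomposition by metis
      then show "blinfun_apply f u \<le> p x + p y"
        by (simp add: blinfun.add_right add_mono le_p)
    qed (use xy in simp)
    \<comment> \<open>Suprema over \<open>v\<close> and over \<open>w\<close> are taken one after
      the other, as \<open>v + w\<close> lies in \<open>{0..x + y}\<close>.\<close>
    have "p x \<le> p (x + y) - p y"
    proof (rule p_le)
      fix v assume v: "0 \<le> v" "v \<le> x"
      have "p y \<le> p (x + y) - blinfun_apply f v"
      proof (rule p_le)
        fix w assume w: "0 \<le> w" "w \<le> y"
        show "blinfun_apply f w \<le> p (x + y) - blinfun_apply f v"
          using le_p[of "v + w" "x + y"] v w by (simp add: blinfun.add_right add_mono)
      qed (use xy in simp)
      then show "blinfun_apply f v \<le> p (x + y) - p y"
        by simp
    qed (use xy in simp)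
    then show "p x + p y \<le> p (x + y)"
      by simp
  qed
  have p_scaleR_le: "p (c *\<^sub>R x) \<le> c * p x" if "0 \<le> x" "0 < c" for c x
  proof (rule p_le)
    fix u assume u: "0 \<le> u" "u \<le> c *\<^sub>R x"
    have "inverse c *\<^sub>R u \<le> inverse c *\<^sub>R (c *\<^sub>R x)"
      using u that by (intro scaleR_left_mono) auto
    then have "blinfun_apply f (inverse c *\<^sub>R u) \<le> p x"
      using u that by (intro le_p scaleR_nonneg_nonneg) auto
    then show "blinfun_apply f u \<le> c * p x"
      using that by (simp add: blinfun.scaleR_right field_simps)
  qed (use that in \<open>simp add: scaleR_nonneg_nonneg\<close>)
  have p_scaleR: "p (c *\<^sub>R x) = c * p x" if "0 \<le> x" "0 < c" for c x
  proof (rule antisym)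
    \<comment> \<open>The reverse inequality is the one already shown, for the scalar
      \<open>inverse c\<close> and the scaled vector.\<close>
    have "p (inverse c *\<^sub>R (c *\<^sub>R x)) \<le> inverse c * p (c *\<^sub>R x)"
      using that by (intro p_scaleR_le scaleR_nonneg_nonneg) auto
    then show "c * p x \<le> p (c *\<^sub>R x)"
      using that by (simp add: field_simps)
  qed (use p_scaleR_le that in blast)
  define s where "s x = p (pprt x) - p (pprt (- x))" for x
  have prts': "x = pprt x - pprt (- x)" for x :: 'a
    using prts[of x] by (simp add: pprt_neg)
  \<comment> \<open>The extension is independent of how a vector is written as a difference of
    positive ones, by additivity of \<open>p\<close>. Linearity of \<open>s\<close> rests on
    this.\<close>
  have s_diff: "s (a - b) = p a - p b" if "0 \<le> a" "0 \<le> b" for a b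
  proof -
    have "pprt (a - b) + b = a + pprt (- (a - b))"
      using prts'[of "a - b"] by (simp add: algebra_simps)
    then have "p (pprt (a - b)) + p b = p a + p (pprt (- (a - b)))"
      using that p_add by (metis zero_le_pprt)
    then show ?thesis
      by (simp add: s_def)
  qed
  have s_minus: "s (- x) = - s x" for x
    by (simp add: s_def)
  have s_scaleR_pos: "s (c *\<^sub>R x) = c * s x" if "0 < c" for c x
  proof -
    have "s (c *\<^sub>R x) = s (c *\<^sub>R pprt x - c *\<^sub>R pprt (- x))"
      using prts'[of x] by (metis scaleR_diff_right)
    also have "\<dots> = p (c *\<^sub>R pprt x) - p (c *\<^sub>R pprt (- x))"
      using that by (intro s_diff scaleR_nonneg_nonneg) auto
    also have "\<dots> = c * s x"
      using that by (simp add: p_scaleR s_def algebra_simps)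
    finally show ?thesis .
  qed
  have s_scaleR: "s (c *\<^sub>R x) = c * s x" for c x
  proof (cases c "0::real" rule: linorder_cases)
    case less
    then show ?thesis
      using s_scaleR_pos[of "- c" x] s_minus[of "c *\<^sub>R x"] by simp
  qed (use s_scaleR_pos in \<open>auto simp: s_def\<close>)
  have s_add: "s (x + y) = s x + s y" for x y
  proof -
    have "s (x + y) = s ((pprt x + pprt y) - (pprt (- x) + pprt (- y)))"
      using prts'[of x] prts'[of y] by (metis add_diff_add)
    also have "\<dots> = p (pprt x + pprt y) - p (pprt (- x) + pprt (- y))"
      by (intro s_diff) auto
    also have "\<dots> = s x + s y"
      by (simp add: p_add s_def)
    finally show ?thesis .
  qed
  have s_norm: "norm (s x) \<le> norm x * norm f" for x
  proof -
    have part: "p (pprt y) \<le> norm x * norm f" if "norm y = norm x" for y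
    proof -
      have "p (pprt y) \<le> norm f * norm (pprt y)"
        by (intro p_bound) simp
      also have "\<dots> \<le> norm f * norm x"
        using norm_pprt_le[of y] that by (intro mult_left_mono) auto
      finally show ?thesis
        by (simp add: mult.commute)
    qed
    \<comment> \<open>Both terms of \<open>s x\<close> lie between \<open>0\<close> and
      \<open>norm x * norm f\<close>, so their difference obeys the same bound without a factor
      2.\<close>
    show ?thesis
      using part[of x] part[of "- x"] p_nonneg[of "pprt x"] p_nonneg[of "pprt (- x)"]
      by (auto simp: s_def abs_le_iff)
  qed
  have "bounded_linear s"
    by (rule bounded_linear_intro[OF s_add _ s_norm]) (simp add: s_scaleR)
  then have s_apply: "blinfun_apply (Blinfun s) = s"
    by (rule bounded_linear_Blinfun_apply)
  have p0: "p 0 = 0"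
    using p_add[of 0 0] by simp
  have "blinfun_apply (Blinfun s) x = (SUP u\<in>{0..x}. blinfun_apply f u)" if "0 \<le> x" for x
    using s_diff[of x 0] that p0 by (simp add: s_apply p_def)
  then show thesis
    by (rule that) (simp_all add: bdd)
qed

text \<open>With \<open>t\<close> the positive part of \<open>f - g\<close>, the functional
  \<open>g + t\<close> is an upper bound of \<open>f\<close> and \<open>g\<close>, so it dominates
  the least one. A near-maximiser in the formula for \<open>t\<close> at \<open>x\<close> then
  serves as \<open>u\<close>.\<close>

lemma dual_is_sup_approx:
  fixes f g s :: "'a::banach_lattice \<Rightarrow>\<^sub>L real"
  assumes sup: "dual_is_sup f g s" and "0 \<le> x" "0 < e"
  obtains u where "u \<in> {0..x}"
    "blinfun_apply s x < blinfun_apply f u + blinfun_apply g (x - u) + e"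
proof -
  obtain t where t: "\<And>x. 0 \<le> x \<Longrightarrow> blinfun_apply t x = (SUP u\<in>{0..x}. blinfun_apply (f - g) u)"
    and bdd: "\<And>x. 0 \<le> x \<Longrightarrow> bdd_above (blinfun_apply (f - g) ` {0..x})"
    by (rule riesz_kantorovich_pos[of "f - g"]) (rule that)
  have upper: "blinfun_apply (f - g) u \<le> blinfun_apply t x" if "0 \<le> u" "u \<le> x" for u x
  proof -
    have "0 \<le> x"
      using that by (rule order_trans)
    then show ?thesis
      unfolding t[OF \<open>0 \<le> x\<close>] using that by (intro cSUP_upper bdd) auto
  qed
  \<comment> \<open>The endpoints \<open>u = x\<close> and \<open>u = 0\<close> in the formula for
    \<open>t\<close> give the bounds for \<open>f\<close> and \<open>g\<close> respectively.\<close>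
  have "dual_le f (g + t)"
    unfolding dual_le_def
  proof (intro allI impI)
    fix x :: 'a assume "0 \<le> x"
    then show "blinfun_apply f x \<le> blinfun_apply (g + t) x"
      using upper[of x x] by (simp add: blinfun.diff_left blinfun.add_left)
  qed
  moreover have "dual_le g (g + t)"
    unfolding dual_le_def
  proof (intro allI impI)
    fix x :: 'a assume "0 \<le> x"
    then show "blinfun_apply g x \<le> blinfun_apply (g + t) x"
      using upper[of 0 x] by (simp add: blinfun.zero_right blinfun.add_left)
  qed
  ultimately have "dual_le s (g + t)"
    using sup by (simp add: dual_is_sup_def)
  then have "blinfun_apply s x \<le> blinfun_apply g x + blinfun_apply t x"
    using \<open>0 \<le> x\<close> by (simp add: dual_le_def blinfun.add_left)
  moreover obtain u where "u \<in> {0..x}" "blinfun_apply t x - e < blinfun_apply (f - g) u"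
    using less_cSUP_iff[OF _ bdd[OF \<open>0 \<le> x\<close>], of "blinfun_apply t x - e"] t[OF \<open>0 \<le> x\<close>] assms(2,3)
    by auto
  ultimately show ?thesis
    using that[of u] by (simp add: blinfun.diff_left blinfun.diff_right)
qed

section \<open>The adjoint is a lattice homomorphism\<close>

text \<open>Negation reverses the dual order. This lets disjointness be treated through suprema
  alone.\<close>

lemma dual_is_inf_iff_sup: "dual_is_inf f g i \<longleftrightarrow> dual_is_sup (- f) (- g) (- i)"
proof -
  have minus: "dual_le (- a) b \<longleftrightarrow> dual_le (- b) a" for a b :: "'a \<Rightarrow>\<^sub>L real"
    by (auto simp: dual_le_def blinfun.minus_left minus_le_iff)
  show ?thesis
    unfolding dual_is_inf_def dual_is_sup_def by (metis minus minus_minus)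
qed

lemma dual_is_sup_compose:
  fixes T :: "'a::banach_lattice \<Rightarrow>\<^sub>L 'b::banach_lattice"
  assumes T: "almost_interval_preserving (blinfun_apply T)" and sup: "dual_is_sup f g s"
  shows "dual_is_sup (f o\<^sub>L T) (g o\<^sub>L T) (s o\<^sub>L T)"
  unfolding dual_is_sup_def
proof (intro conjI allI impI)
  have pos: "0 \<le> blinfun_apply T x" if "0 \<le> x" for x
    using T that by (simp add: almost_interval_preserving_def)
  show "dual_le (f o\<^sub>L T) (s o\<^sub>L T)" "dual_le (g o\<^sub>L T) (s o\<^sub>L T)"
    using sup pos by (auto simp: dual_is_sup_def dual_le_def)
  fix h assume h: "dual_le (f o\<^sub>L T) h" "dual_le (g o\<^sub>L T) h"
  show "dual_le (s o\<^sub>L T) h"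
    unfolding dual_le_def
  proof (intro allI impI)
    fix x :: 'a assume x: "0 \<le> x"
    define k where "k u = blinfun_apply f u + blinfun_apply g (blinfun_apply T x - u)" for u
    \<comment> \<open>By linearity \<open>T x - T y\<close> is \<open>T (x - y)\<close>; since
      \<open>y\<close> and \<open>x - y\<close> are both positive, the two bounds by
      \<open>h\<close> apply and add up to \<open>h\<close> at \<open>x\<close>.\<close>
    have "k (blinfun_apply T y) \<le> blinfun_apply h x" if y: "y \<in> {0..x}" for y
    proof -
      have "k (blinfun_apply T y) = blinfun_apply (f o\<^sub>L T) y + blinfun_apply (g o\<^sub>L T) (x - y)"
        by (simp add: k_def blinfun.diff_right)
      also have "\<dots> \<le> blinfun_apply h y + blinfun_apply h (x - y)"
        using h y by (intro add_mono) (auto simp: dual_le_def)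
      also have "\<dots> = blinfun_apply h x"
        by (simp add: blinfun.diff_right)
      finally show ?thesis .
    qed
    then have "k ` (blinfun_apply T ` {0..x}) \<subseteq> {..blinfun_apply h x}"
      by auto
    moreover have "continuous_on UNIV k"
      unfolding k_def by (intro continuous_intros)
    ultimately have "k ` closure (blinfun_apply T ` {0..x}) \<subseteq> {..blinfun_apply h x}"
      by (intro image_closure_subset) (auto intro: continuous_on_subset)
    then have k_le: "k u \<le> blinfun_apply h x" if "u \<in> {0..blinfun_apply T x}" for u
      using T x that unfolding almost_interval_preserving_def by blast
    show "blinfun_apply (s o\<^sub>L T) x \<le> blinfun_apply h x"
    proof (rule field_le_epsilon)
      fix e :: real assume "0 < e"
      then obtain u where "u \<in> {0..blinfun_apply T x}" "blinfun_apply s (blinfun_apply T x) < k u + e"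
        unfolding k_def using dual_is_sup_approx[OF sup pos[OF x]] by metis
      then show "blinfun_apply (s o\<^sub>L T) x \<le> blinfun_apply h x + e"
        using k_le[of u] by simp
    qed
  qed
qed

text \<open>A modulus is the supremum of a functional and its negative, and an infimum becomes a
  supremum after negation. Composition with \<open>T\<close> commutes with negation, so both are
  preserved.\<close>

lemma disjoint_seq_compose:
  fixes T :: "'a::banach_lattice \<Rightarrow>\<^sub>L 'b::banach_lattice"
  assumes T: "almost_interval_preserving (blinfun_apply T)" and f: "disjoint_seq f"
  shows "disjoint_seq (\<lambda>n. f n o\<^sub>L T)"
proof -
  have minus: "- g o\<^sub>L T = - (g o\<^sub>L T)" for g :: "'b \<Rightarrow>\<^sub>L real"
    by (rule blinfun_eqI) (simp add: blinfun.minus_left)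
  have modulus: "dual_is_modulus (g o\<^sub>L T) (m o\<^sub>L T)" if "dual_is_modulus g m" for g m
    using dual_is_sup_compose[OF T] that by (metis dual_is_modulus_def minus)
  have inf: "dual_is_inf (m o\<^sub>L T) (n o\<^sub>L T) 0" if "dual_is_inf m n 0" for m n
    using dual_is_sup_compose[OF T, of "- m" "- n" 0] that
    by (simp add: dual_is_inf_iff_sup minus)
  show ?thesis
    using f modulus inf unfolding disjoint_seq_def dual_disjoint_def by meson
qed

text \<open>Composition with \<open>T\<close> is bounded and linear between the duals, so each test
  functional \<open>\<phi>\<close> pulls back to one against which \<open>f\<close> is already
  null.\<close>

lemma weakly_null_compose:
  fixes f :: "nat \<Rightarrow> 'b::real_normed_vector \<Rightarrow>\<^sub>L real"
  assumes "weakly_null f"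
  shows "weakly_null (\<lambda>n. f n o\<^sub>L T)"
  unfolding weakly_null_def
proof
  fix \<phi> :: "('a \<Rightarrow>\<^sub>L real) \<Rightarrow>\<^sub>L real"
  have lin: "bounded_linear (\<lambda>g. blinfun_apply \<phi> (g o\<^sub>L T))"
    by (rule bounded_linear_compose[OF blinfun.bounded_linear_right
          bounded_bilinear.bounded_linear_left[OF bounded_bilinear_blinfun_compose]])
  have "(\<lambda>n. blinfun_apply (Blinfun (\<lambda>g. blinfun_apply \<phi> (g o\<^sub>L T))) (f n)) \<longlonglongrightarrow> 0"
    using assms by (simp add: weakly_null_def)
  then show "(\<lambda>n. blinfun_apply \<phi> (f n o\<^sub>L T)) \<longlonglongrightarrow> 0"
    by (simp add: bounded_linear_Blinfun_apply[OF lin])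
qed

theorem theorem2p23:
  fixes T :: "'a::banach_lattice \<Rightarrow> 'b::banach_lattice" and A :: "'a set"
  assumes "almost_interval_preserving T"
  shows "(almost_dunford_pettis A \<longrightarrow> almost_dunford_pettis (T ` A)) \<and>
         (almost_limited A \<longrightarrow> almost_limited (T ` A))"
proof -
  have "bounded_linear T"
    using assms by (intro positive_operator_bounded_linear) (auto simp: almost_interval_preserving_def)
  \<comment> \<open>Passing to a bounded operator makes the adjoint available as composition with
    \<open>S\<close>.\<close>
  then obtain S where S: "blinfun_apply S = T"
    using bounded_linear_Blinfun_apply by blast
  have disj: "disjoint_seq (\<lambda>n. f n o\<^sub>L S)" if "disjoint_seq f" for f
    using assms that by (intro disjoint_seq_compose) (simp_all add: S)
  have lim: "uniform_limit (T ` A) (\<lambda>n. blinfun_apply (f n)) (\<lambda>_. 0) sequentially"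
    if "uniform_limit A (\<lambda>n. blinfun_apply (f n o\<^sub>L S)) (\<lambda>_. 0) sequentially" for f :: "nat \<Rightarrow> 'b \<Rightarrow>\<^sub>L real"
    using that by (simp add: uniform_limit_iff S)
  have "weak_star_null (\<lambda>n. f n o\<^sub>L S)" if "weak_star_null f" for f :: "nat \<Rightarrow> 'b \<Rightarrow>\<^sub>L real"
    using that by (simp add: weak_star_null_def)
  then show ?thesis
    unfolding almost_dunford_pettis_def almost_limited_def
    using disj lim weakly_null_compose by blast
qed

end
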